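(* Let $\gamma\ge0$, $d\ge0$, $a\ge0$ be constants and set $\mathcal{L}_1^-[u]:=\mathcal{M}^-(D^2u)-\gamma|Du|-du$. Let $f\in C[0,+\infty)$ be defined by $f(s)=a\,s\,|\ln s|$ if $s>0$ and $f(0)=0$. Then the strong maximum principle holds for the operator $\mathcal{L}_1^-[\cdot]-f(\cdot)$, i.e. if $u$ is a $C$-viscosity solution of $$\mathcal{L}_1^-[u]\le f(u)\ \text{ in }\Omega,\qquad u\ge0\ \text{ in }\Omega,$$ then either $u>0$ in $\Omega$ or $u\equiv0$ in $\Omega$.
   Context: $\Omega\subset\mathbb{R}^n$ is a bounded domain (open and connected) with $C^{1,1}$ boundary. $\mathcal{M}^-(X)=\inf_{\lambda_P I\le A\le\Lambda_P I}\mathrm{tr}(AX)$ is the Pucci operator with constants $0<\lambda_P\le\Lambda_P$. A $C$-viscosity solution of the inequality $\mathcal{L}_1^-[u]\le f(u)$ is a viscosity supersolution in the usual (Crandall–Ishii–Lions) sense: $u$ is lower semicontinuous in $\Omega$, and whenever $\phi\in C^2$ near $x_0\in\Omega$ and $u-\phi$ has a local minimum at $x_0$, then $\mathcal{M}^-(D^2\phi(x_0))-\gamma|D\phi(x_0)|-d\,u(x_0)\le f(u(x_0))$. *)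

theory Defs
  imports "HOL-Analysis.Analysis"
begin

definition C11 :: "('a::euclidean_space \<Rightarrow> real) \<Rightarrow> bool" where
  "C11 h \<longleftrightarrow> (\<exists>g L. (\<forall>x. GDERIV h x :> g x) \<and> L-lipschitz_on UNIV g)"

(* Near each boundary point, in the orthonormal coordinates given by some unit
   vector e and its orthogonal complement, S is the part of a ball strictly above
   the graph of a C^{1,1} function h of the coordinates orthogonal to e; only the
   values of h on the hyperplane orthogonal to e matter. *)
definition C11_boundary :: "'a::euclidean_space set \<Rightarrow> bool" where
  "C11_boundary S \<longleftrightarrow>
     (\<forall>x\<^sub>0\<in>frontier S. \<exists>r>0. \<exists>e h. norm e = 1 \<and> C11 h \<and>
        S \<inter> ball x\<^sub>0 r = {y \<in> ball x\<^sub>0 r. h (y - (y \<bullet> e) *\<^sub>R e) < y \<bullet> e})"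

definition loewner_le :: "real^'n^'n \<Rightarrow> real^'n^'n \<Rightarrow> bool" where
  "loewner_le A B \<longleftrightarrow> (\<forall>v. v \<bullet> (A *v v) \<le> v \<bullet> (B *v v))"

(* A ranges over symmetric matrices.  For 0 < l \<le> M the set is nonempty and the traces
   are bounded, so the real-valued Inf is the genuine infimum. *)
definition pucci_minus :: "real \<Rightarrow> real \<Rightarrow> real^'n^'n \<Rightarrow> real" where
  "pucci_minus l M X =
     (INF A\<in>{A. transpose A = A \<and> loewner_le (mat l) A \<and> loewner_le A (mat M)}. trace (A ** X))"

(* The operator as a function of the Hessian X, the gradient p and the value s. *)
definition L1_minus ::
    "real \<Rightarrow> real \<Rightarrow> real \<Rightarrow> real \<Rightarrow> real^'n^'n \<Rightarrow> real^'n \<Rightarrow> real \<Rightarrow> real" where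
  "L1_minus l M \<gamma> d X p s = pucci_minus l M X - \<gamma> * norm p - d * s"

definition lsc_on :: "'a::topological_space set \<Rightarrow> ('a \<Rightarrow> real) \<Rightarrow> bool" where
  "lsc_on S u \<longleftrightarrow> (\<forall>x\<in>S. \<forall>c<u x. \<forall>\<^sub>F y in at x within S. c < u y)"

definition C2_on_with ::
    "(real^'n) set \<Rightarrow> (real^'n \<Rightarrow> real) \<Rightarrow> (real^'n \<Rightarrow> real^'n) \<Rightarrow> (real^'n \<Rightarrow> real^'n^'n) \<Rightarrow> bool" where
  "C2_on_with U \<phi> D H \<longleftrightarrow>
     (\<forall>x\<in>U. GDERIV \<phi> x :> D x \<and> (D has_derivative (\<lambda>v. H x *v v)) (at x)) \<and> continuous_on U H"

(* C-viscosity solutions of F(D^2 u, Du, u) \<le> f(u) in the open set S.  Since S is open,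
   u and the test functions being total does not matter: only values near x0 enter. *)
definition visc_supersol ::
    "(real^'n^'n \<Rightarrow> real^'n \<Rightarrow> real \<Rightarrow> real) \<Rightarrow> (real \<Rightarrow> real) \<Rightarrow> (real^'n) set \<Rightarrow> (real^'n \<Rightarrow> real) \<Rightarrow> bool" where
  "visc_supersol F f S u \<longleftrightarrow>
     lsc_on S u \<and>
     (\<forall>x\<^sub>0\<in>S. \<forall>\<phi> U D H.
        open U \<and> x\<^sub>0 \<in> U \<and> C2_on_with U \<phi> D H \<and>
        (\<forall>\<^sub>F x in at x\<^sub>0. u x\<^sub>0 - \<phi> x\<^sub>0 \<le> u x - \<phi> x)
        \<longrightarrow> F (H x\<^sub>0) (D x\<^sub>0) (u x\<^sub>0) \<le> f (u x\<^sub>0))"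

end

theory Submission
  imports Defs
begin

text \<open>Suppose that \<open>u\<close> vanishes somewhere in the domain but not everywhere. The positivity set of
  \<open>u\<close> is open by lower semicontinuity, and since the domain is connected there is a closed ball
  \<open>B\<close>, with centre \<open>c\<close> and radius \<open>R\<close>, that meets the zero set of \<open>u\<close> in exactly one point
  \<open>z\<close>, which is an interior point of the domain (\<open>interior_touching_ball\<close>).

  Take a small closed ball \<open>K\<close> around \<open>z\<close> and the barrier
  \<open>v(x) = m (exp(- \<alpha> |x - c|\<^sup>2) - exp(- \<alpha> R\<^sup>2))\<close>, where \<open>m > 0\<close> is a lower bound of \<open>u\<close> on
  the part of the boundary of \<open>K\<close> that lies in \<open>B\<close>. The lower semicontinuous function \<open>u - v\<close>
  vanishes at \<open>z\<close>, is positive outside \<open>B\<close> because \<open>v\<close> is negative there, and is positive on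
  the boundary of \<open>K\<close> inside \<open>B\<close> because \<open>v < m\<close>. So its minimum over \<open>K\<close> is nonpositive and
  is attained at an interior point \<open>y\<close> of \<open>K\<close> that belongs to \<open>B\<close>, with \<open>0 \<le> u(y) \<le> v(y)\<close>.
  There \<open>v\<close> is an admissible test function. This single test replaces the usual two steps, a
  comparison in an annulus followed by the Hopf boundary lemma.

  The test is contradictory once \<open>v\<close> is a strict subsolution, uniformly for zero order values
  \<open>s\<close> between \<open>0\<close> and \<open>v\<close> (\<open>gauss_barrier_strict_subsolution\<close>). Divide everything by
  \<open>m exp(- \<alpha> |x - c|\<^sup>2)\<close>. The Pucci term is then at least a positive multiple of \<open>\<alpha>\<^sup>2\<close> minus
  a multiple of \<open>\<alpha>\<close>, and the drift and linear terms grow at most linearly. The function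
  \<open>s |ln s|\<close> is not bounded by a multiple of \<open>s\<close> near \<open>0\<close>, but the logarithm of the barrier
  is only of size \<open>\<alpha> R\<^sup>2 + |ln m|\<close>, up to a term controlled by \<open>q |ln q| \<le> 1\<close> for \<open>q\<close> in
  \<open>(0, 1]\<close>; hence it also costs just a linear term (\<open>entropy_le\<close>). A large \<open>\<alpha>\<close> wins,
  and it may be chosen after \<open>m\<close>.\<close>

section \<open>Lower semicontinuous functions\<close>

lemma lsc_on_subset:
  assumes "lsc_on S u" and "T \<subseteq> S"
  shows "lsc_on T u"
  using assms unfolding lsc_on_def by (meson at_le filter_leD subsetD)

lemma lsc_on_openD:
  assumes "lsc_on S u" and "open S" and "x \<in> S" and "c < u x"
  shows "\<exists>e>0. \<forall>y\<in>ball x e. c < u y"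
proof -
  have "\<forall>\<^sub>F y in at x. c < u y"
    using assms unfolding lsc_on_def by (metis at_within_open)
  then obtain e where "e > 0" "\<And>y. y \<noteq> x \<Longrightarrow> dist y x < e \<Longrightarrow> c < u y"
    unfolding eventually_at by auto
  then show ?thesis
    using assms(4) by (metis dist_commute mem_ball)
qed

lemma lsc_on_diff_continuous:
  assumes "lsc_on S u" and "continuous_on S v"
  shows "lsc_on S (\<lambda>x. u x - v x)"
  unfolding lsc_on_def
proof (intro ballI allI impI)
  fix x c assume x: "x \<in> S" and c: "c < u x - v x"
  define e where "e = (u x - v x - c) / 2"
  have e: "e > 0" using c by (simp add: e_def)
  have "\<forall>\<^sub>F y in at x within S. u x - e < u y"
    using assms(1) x e by (auto simp: lsc_on_def)
  moreover have "\<forall>\<^sub>F y in at x within S. v y < v x + e"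
    using assms(2) x e by (intro order_tendstoD) (auto simp: continuous_on)
  ultimately show "\<forall>\<^sub>F y in at x within S. c < u y - v y"
    by eventually_elim (simp add: e_def field_simps)
qed

text \<open>If no minimum existed, every point would have a neighbourhood on which the function exceeds
  one of its own values; finitely many neighbourhoods suffice, and the point carrying the least of
  the corresponding values would lie in none of them.\<close>

lemma lsc_on_compact_attains_min:
  fixes u :: "'a::topological_space \<Rightarrow> real"
  assumes "compact K" and "K \<noteq> {}" and "lsc_on K u"
  shows "\<exists>x\<in>K. \<forall>y\<in>K. u x \<le> u y"
proof (rule ccontr)
  assume "\<not> ?thesis"
  then have "\<forall>x\<in>K. \<exists>y. y \<in> K \<and> u y < u x" by (meson not_le)
  then obtain g where g: "\<And>x. x \<in> K \<Longrightarrow> g x \<in> K \<and> u (g x) < u x" by metis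
  have "\<exists>W. open W \<and> x \<in> W \<and> (\<forall>y\<in>W \<inter> K. u (g x) < u y)" if "x \<in> K" for x
  proof -
    have "\<forall>\<^sub>F y in at x within K. u (g x) < u y"
      using assms(3) g that by (auto simp: lsc_on_def)
    then show ?thesis
      unfolding eventually_at_topological using g[OF that] by (metis IntD1 IntD2)
  qed
  then obtain W where W: "\<And>x. x \<in> K \<Longrightarrow> open (W x) \<and> x \<in> W x \<and> (\<forall>y\<in>W x \<inter> K. u (g x) < u y)"
    by metis
  have "K \<subseteq> (\<Union>x\<in>K. W x)" using W by blast
  then obtain C where C: "C \<subseteq> K" "finite C" "K \<subseteq> (\<Union>x\<in>C. W x)"
    using compactE_image[OF assms(1), of K W] W by metis
  have "C \<noteq> {}" using C assms(2) by auto
  define c where "c = arg_min_on (u \<circ> g) C"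
  have c: "c \<in> C" "\<And>x. x \<in> C \<Longrightarrow> u (g c) \<le> u (g x)"
    using arg_min_if_finite[OF C(2) \<open>C \<noteq> {}\<close>, of "u \<circ> g"]
    by (auto simp: c_def not_less)
  have gcK: "g c \<in> K" using c C g by auto
  then obtain x where x: "x \<in> C" "g c \<in> W x" using C by blast
  then have "u (g x) < u (g c)" using W gcK C(1) by blast
  with c(2)[OF x(1)] show False by simp
qed

section \<open>A ball of positivity touching the zero set at one point\<close>

text \<open>A ball centred at a point of \<open>P\<close> close to the relative boundary of \<open>P\<close> in \<open>S\<close> is enlarged until
  it meets \<open>S - P\<close> at some \<open>z\<close>. The ball of half the radius that is internally tangent to it at
  \<open>z\<close> then leaves \<open>P\<close> only there. Starting close enough to the boundary of \<open>P\<close> keeps all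
  these balls inside \<open>S\<close>.\<close>

lemma interior_touching_ball:
  fixes S P :: "'a::euclidean_space set"
  assumes "open S" and "connected S" and "open P" and "P \<subseteq> S" and "P \<noteq> {}" and "P \<noteq> S"
  obtains c R z where "0 < R" and "z \<in> S - P" and "dist c z = R"
    and "\<And>y. dist c y \<le> R \<Longrightarrow> y \<noteq> z \<Longrightarrow> y \<in> P"
proof -
  have "\<exists>z0\<in>S - P. z0 \<in> closure P"
  proof (rule ccontr)
    assume "\<not> ?thesis"
    then have "S - P = S \<inter> - closure P" using closure_subset by blast
    then have "open (S - P)" using assms(1) by (metis closed_closure open_Compl open_Int)
    then show False
      using connectedD[OF assms(2,3), of "S - P"] assms(4-6) by blast
  qed
  then obtain z0 where z0: "z0 \<in> S" "z0 \<notin> P" "z0 \<in> closure P" by blast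
  obtain r where r: "r > 0" "cball z0 r \<subseteq> S"
    using assms(1) z0(1) open_contains_cball by metis
  obtain p where p: "p \<in> P" "dist p z0 < r / 2"
    using z0(3) r(1) unfolding closure_approachable by (meson half_gt_zero)
  have "compact (cball z0 r - P)"
    using assms(3) by (simp add: compact_diff)
  moreover have "z0 \<in> cball z0 r - P" using z0 r by auto
  ultimately obtain z where z: "z \<in> cball z0 r - P"
      and zmin: "\<And>y. y \<in> cball z0 r - P \<Longrightarrow> dist p z \<le> dist p y"
    using distance_attains_inf[of "cball z0 r - P" p] compact_imp_closed by (metis empty_iff)
  have pz: "dist p z < r / 2"
    using zmin[OF \<open>z0 \<in> cball z0 r - P\<close>] p(2) by simp
  have inP: "y \<in> P" if "dist p y < dist p z" for y
  proof (rule ccontr)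
    assume "y \<notin> P"
    have "dist z0 y \<le> dist p z0 + dist p y" by (metis dist_commute dist_triangle)
    then have "y \<in> cball z0 r - P" using that pz p(2) \<open>y \<notin> P\<close> by auto
    then show False using zmin that by fastforce
  qed
  define R where "R = dist p z / 2"
  define c where "c = midpoint p z"
  show thesis
  proof (rule that[of R z c])
    show "0 < R" using z p(1) by (auto simp: R_def)
    show "z \<in> S - P" using z r by auto
    show "dist c z = R" by (simp add: c_def R_def dist_midpoint)
    fix y assume y: "dist c y \<le> R" "y \<noteq> z"
    show "y \<in> P"
    proof (rule inP, rule ccontr)
      assume "\<not> dist p y < dist p z"
      define v where "v = c - p"
      define w where "w = y - c"
      have v: "norm v = R"
        by (simp add: v_def R_def c_def dist_norm[symmetric] dist_midpoint)
      have w: "norm w \<le> R" using y by (simp add: w_def dist_norm norm_minus_commute)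
      have "norm (v + w) \<ge> 2 * R"
        using \<open>\<not> dist p y < dist p z\<close> by (simp add: v_def w_def R_def dist_norm norm_minus_commute)
      then have "(2 * R)\<^sup>2 \<le> (norm (v + w))\<^sup>2" using \<open>0 < R\<close> by (intro power_mono) auto
      moreover have "(norm w)\<^sup>2 \<le> R\<^sup>2" using w by (intro power_mono) auto
      moreover have "(norm (v - w))\<^sup>2 = 2 * (norm v)\<^sup>2 + 2 * (norm w)\<^sup>2 - (norm (v + w))\<^sup>2"
        by (simp add: power2_norm_eq_inner inner_add inner_diff inner_commute)
      \<comment> \<open>Strict convexity: by the parallelogram law, equality in the triangle inequality
          forces \<open>v = w\<close>.\<close>
      ultimately have "(norm (v - w))\<^sup>2 \<le> 0" using v by (simp add: power2_eq_square)
      then have "v = w" by simp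
      then have "y = 2 *\<^sub>R c - p" by (simp add: v_def w_def scaleR_2 algebra_simps)
      also have "\<dots> = z" by (simp add: c_def midpoint_def scaleR_2 algebra_simps)
      finally show False using y(2) by simp
    qed
  qed
qed

section \<open>The Gaussian barrier\<close>

definition gauss_barrier :: "real \<Rightarrow> real \<Rightarrow> real \<Rightarrow> real^'n \<Rightarrow> real^'n \<Rightarrow> real" where
  "gauss_barrier m \<alpha> R c x = m * (exp (- \<alpha> * ((x - c) \<bullet> (x - c))) - exp (- \<alpha> * R\<^sup>2))"

definition gauss_grad :: "real \<Rightarrow> real \<Rightarrow> real^'n \<Rightarrow> real^'n \<Rightarrow> real^'n" where
  "gauss_grad m \<alpha> c x = (- (2 * \<alpha> * m * exp (- \<alpha> * ((x - c) \<bullet> (x - c))))) *\<^sub>R (x - c)"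

definition outer_square :: "real^'n \<Rightarrow> real^'n^'n" where
  "outer_square y = (\<chi> i j. y $ i * y $ j)"

definition gauss_hess :: "real \<Rightarrow> real \<Rightarrow> real^'n \<Rightarrow> real^'n \<Rightarrow> real^'n^'n" where
  "gauss_hess m \<alpha> c x = (m * exp (- \<alpha> * ((x - c) \<bullet> (x - c)))) *\<^sub>R
     ((4 * \<alpha>\<^sup>2) *\<^sub>R outer_square (x - c) - (2 * \<alpha>) *\<^sub>R mat 1)"

lemma outer_square_mult: "outer_square y *v v = (y \<bullet> v) *\<^sub>R y"
  by (simp add: outer_square_def vec_eq_iff matrix_vector_mult_def inner_vec_def
      sum_distrib_left sum_distrib_right mult_ac)

lemma gauss_hess_mult:
  "gauss_hess m \<alpha> c x *v v = (m * exp (- \<alpha> * ((x - c) \<bullet> (x - c)))) *\<^sub>R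
     ((4 * \<alpha>\<^sup>2 * ((x - c) \<bullet> v)) *\<^sub>R (x - c) - (2 * \<alpha>) *\<^sub>R v)"
  unfolding gauss_hess_def
  by (simp add: scaleR_matrix_vector_assoc[symmetric] matrix_vector_mult_diff_rdistrib
      outer_square_mult)

lemma gauss_barrier_C2:
  "C2_on_with U (gauss_barrier m \<alpha> R c) (gauss_grad m \<alpha> c) (gauss_hess m \<alpha> c)"
  unfolding C2_on_with_def
proof (intro conjI ballI)
  fix x
  show "GDERIV (gauss_barrier m \<alpha> R c) x :> gauss_grad m \<alpha> c x"
    unfolding gderiv_def gauss_barrier_def gauss_grad_def
    by (auto intro!: derivative_eq_intros simp: fun_eq_iff inner_commute algebra_simps)
  have "(gauss_grad m \<alpha> c has_derivative
      (\<lambda>v. (m * exp (- \<alpha> * ((x - c) \<bullet> (x - c)))) *\<^sub>R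
        ((4 * \<alpha>\<^sup>2 * ((x - c) \<bullet> v)) *\<^sub>R (x - c) - (2 * \<alpha>) *\<^sub>R v))) (at x)"
    unfolding gauss_grad_def
    by (rule derivative_eq_intros refl)+
       (simp add: fun_eq_iff inner_commute scaleR_diff_right scaleR_diff_left power2_eq_square mult_ac)
  also have "(\<lambda>v. (m * exp (- \<alpha> * ((x - c) \<bullet> (x - c)))) *\<^sub>R
        ((4 * \<alpha>\<^sup>2 * ((x - c) \<bullet> v)) *\<^sub>R (x - c) - (2 * \<alpha>) *\<^sub>R v))
      = (*v) (gauss_hess m \<alpha> c x)"
    by (rule ext) (rule gauss_hess_mult[symmetric])
  finally show "(gauss_grad m \<alpha> c has_derivative (*v) (gauss_hess m \<alpha> c x)) (at x)" .
next
  show "continuous_on U (gauss_hess m \<alpha> c)"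
    unfolding gauss_hess_def outer_square_def
    by (intro continuous_intros)
qed

lemma continuous_on_gauss_barrier: "continuous_on S (gauss_barrier m \<alpha> R c)"
  unfolding gauss_barrier_def by (intro continuous_intros)

lemma trace_mult_outer_square: "trace (A ** outer_square y) = y \<bullet> (A *v y)"
proof -
  have "trace (A ** outer_square y) = (\<Sum>i\<in>UNIV. \<Sum>k\<in>UNIV. A $ i $ k * (y $ k * y $ i))"
    by (simp add: trace_def matrix_matrix_mult_def outer_square_def)
  also have "\<dots> = y \<bullet> (A *v y)"
    by (simp add: inner_vec_def matrix_vector_mult_def sum_distrib_left mult_ac)
  finally show ?thesis .
qed

lemma mat_mult_vector: "mat k *v v = k *\<^sub>R (v :: real^'n)"
  by (simp add: vec_eq_iff matrix_vector_mult_def mat_def if_distrib if_distribR cong: if_cong)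

lemma trace_le_of_loewner_le_mat:
  fixes A :: "real^'n^'n"
  assumes "loewner_le A (mat M)"
  shows "trace A \<le> M * CARD('n)"
proof -
  have "A $ i $ i \<le> M" for i
  proof -
    have "axis i 1 \<bullet> (A *v axis i 1) \<le> axis i 1 \<bullet> (mat M *v axis i (1::real))"
      using assms by (simp add: loewner_le_def)
    then show ?thesis
      by (simp add: mat_mult_vector matrix_vector_mult_basis inner_axis' column_def inner_axis_axis mat_def)
  qed
  then have "trace A \<le> (\<Sum>i\<in>(UNIV::'n set). M)"
    unfolding trace_def by (intro sum_mono)
  then show ?thesis by (simp add: mult.commute)
qed

text \<open>Each admissible \<open>A\<close> has its quadratic form bounded below by \<open>l\<close>, which controls the rank-one
  part, and its diagonal entries bounded above by \<open>M\<close>, which controls the part along the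
  identity.\<close>

lemma pucci_minus_ge:
  fixes y :: "real^'n"
  assumes "l \<le> M" and "0 \<le> b" and "0 \<le> k"
  shows "b * l * (norm y)\<^sup>2 - k * M * CARD('n)
    \<le> pucci_minus l M (b *\<^sub>R outer_square y - k *\<^sub>R mat 1)"
  unfolding pucci_minus_def
proof (rule cINF_greatest)
  have "mat l \<in> {A. transpose A = A \<and> loewner_le (mat l) A \<and> loewner_le A (mat M :: real^'n^'n)}"
    using assms(1)
    by (auto simp: transpose_mat loewner_le_def mat_mult_vector intro: mult_right_mono)
  then show "{A. transpose A = A \<and> loewner_le (mat l) A \<and> loewner_le A (mat M :: real^'n^'n)} \<noteq> {}"
    by blast
  fix A :: "real^'n^'n"
  assume "A \<in> {A. transpose A = A \<and> loewner_le (mat l) A \<and> loewner_le A (mat M)}"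
  then have A: "loewner_le (mat l) A" "loewner_le A (mat M)" by auto
  have "l * (norm y)\<^sup>2 \<le> y \<bullet> (A *v y)"
    using A(1) by (auto simp: loewner_le_def mat_mult_vector power2_norm_eq_inner)
  then have "b * (l * (norm y)\<^sup>2) \<le> b * (y \<bullet> (A *v y))"
    using assms(2) by (rule mult_left_mono)
  moreover have "k * trace A \<le> k * (M * CARD('n))"
    using trace_le_of_loewner_le_mat[OF A(2)] assms(3) by (rule mult_left_mono)
  moreover have "trace (A ** (b *\<^sub>R outer_square y - k *\<^sub>R mat 1)) = b * (y \<bullet> (A *v y)) - k * trace A"
  proof -
    have "A ** (b *\<^sub>R outer_square y - k *\<^sub>R mat 1) = b *\<^sub>R (A ** outer_square y) - k *\<^sub>R A"
      by (simp add: matrix_eq matrix_vector_mul_assoc[symmetric] matrix_vector_mult_diff_rdistrib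
          matrix_vector_mult_diff_distrib scaleR_matrix_vector_assoc[symmetric]
          matrix_vector_mult_scaleR)
    then show ?thesis
      by (simp add: trace_sub trace_mult_outer_square[symmetric])
         (simp add: trace_def sum_distrib_left)
  qed
  ultimately show "b * l * (norm y)\<^sup>2 - k * M * CARD('n)
      \<le> trace (A ** (b *\<^sub>R outer_square y - k *\<^sub>R mat 1))"
    by (simp add: mult.assoc)
qed

lemma L1_minus_gauss_ge:
  fixes c x :: "real^'n"
  assumes "l \<le> M" and "0 \<le> \<alpha>" and "0 \<le> m"
  shows "m * exp (- \<alpha> * (norm (x - c))\<^sup>2) *
      (4 * \<alpha>\<^sup>2 * l * (norm (x - c))\<^sup>2 - 2 * \<alpha> * M * CARD('n) - 2 * \<alpha> * \<gamma> * norm (x - c)) - d * s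
    \<le> L1_minus l M \<gamma> d (gauss_hess m \<alpha> c x) (gauss_grad m \<alpha> c x) s"
proof -
  define E where "E = m * exp (- \<alpha> * (norm (x - c))\<^sup>2)"
  have E: "0 \<le> E" using assms by (simp add: E_def)
  have H: "gauss_hess m \<alpha> c x = (E * (4 * \<alpha>\<^sup>2)) *\<^sub>R outer_square (x - c) - (E * (2 * \<alpha>)) *\<^sub>R mat 1"
    by (simp add: gauss_hess_def E_def power2_norm_eq_inner scaleR_diff_right)
  have "norm (gauss_grad m \<alpha> c x) = 2 * \<alpha> * E * norm (x - c)"
    using assms by (simp add: gauss_grad_def E_def power2_norm_eq_inner abs_mult)
  then show ?thesis
    using pucci_minus_ge[OF assms(1), of "E * (4 * \<alpha>\<^sup>2)" "E * (2 * \<alpha>)" "x - c"] E assms(2)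
    unfolding L1_minus_def H E_def[symmetric] by (simp add: algebra_simps)
qed

section \<open>The logarithmic nonlinearity\<close>

text \<open>Write \<open>s = q E\<close> with \<open>E = m exp(- t)\<close> and \<open>q\<close> in \<open>(0, 1]\<close>. Then
  \<open>|ln s| \<le> |ln m| + t + |ln q|\<close>, and \<open>q |ln q| \<le> 1\<close> absorbs the singularity at \<open>q = 0\<close>.
  The point is that the bound is linear in \<open>t\<close> and does not degenerate as \<open>s\<close> tends to
  \<open>0\<close>.\<close>

lemma entropy_le:
  fixes s m t :: real
  assumes "0 < s" and "s \<le> m * exp (- t)" and "0 < m" and "0 \<le> t"
  shows "s * \<bar>ln s\<bar> \<le> m * exp (- t) * (\<bar>ln m\<bar> + t + 1)"
proof -
  define E where "E = m * exp (- t)"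
  have E: "0 < E" using assms(3) by (simp add: E_def)
  have lnE: "ln E = ln m - t" using assms(3) by (simp add: E_def ln_mult)
  have "ln E - ln s = ln (E / s)" using E assms(1) by (simp add: ln_div)
  also have "\<dots> \<le> E / s - 1" using E assms(1) by (intro ln_le_minus_one) simp
  finally have "s * (ln E - ln s) \<le> s * (E / s - 1)"
    using assms(1) by (intro mult_left_mono) auto
  also have "\<dots> \<le> E" using assms(1) by (simp add: field_simps)
  finally have 1: "s * (ln E - ln s) \<le> E" .
  have "ln s \<le> ln E" using assms(1,2) E by (simp add: E_def)
  then have "\<bar>ln s\<bar> \<le> \<bar>ln E\<bar> + (ln E - ln s)" by linarith
  also have "\<dots> \<le> \<bar>ln m\<bar> + t + (ln E - ln s)" using lnE assms(4) by linarith
  finally have "s * \<bar>ln s\<bar> \<le> s * (\<bar>ln m\<bar> + t + (ln E - ln s))"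
    using assms(1) by (intro mult_left_mono) auto
  also have "\<dots> = s * (\<bar>ln m\<bar> + t) + s * (ln E - ln s)" by (simp add: algebra_simps)
  also have "\<dots> \<le> E * (\<bar>ln m\<bar> + t) + E"
    using 1 assms(2,4) by (intro add_mono mult_right_mono) (auto simp: E_def)
  finally show ?thesis by (simp add: E_def algebra_simps)
qed

lemma quadratic_beats_linear:
  fixes A B C :: real
  assumes "0 < A" and "0 \<le> B" and "0 \<le> C"
  shows "\<exists>\<alpha>>0. B * \<alpha> + C < A * \<alpha>\<^sup>2"
proof (intro exI conjI)
  let ?\<alpha> = "(B + C) / A + 1"
  show pos: "0 < ?\<alpha>" using assms by (simp add: add_nonneg_pos)
  have one: "1 \<le> ?\<alpha>" using assms by simp
  have "A * ?\<alpha>\<^sup>2 = (B + C + A) * ?\<alpha>" using assms(1) by (simp add: power2_eq_square field_simps)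
  moreover have "C * 1 \<le> C * ?\<alpha>" using one assms(3) by (rule mult_left_mono)
  moreover have "0 < A * ?\<alpha>" using assms(1) pos by (rule mult_pos_pos)
  ultimately show "B * ?\<alpha> + C < A * ?\<alpha>\<^sup>2" by (simp only: distrib_right)
qed

text \<open>The bound is needed for every \<open>s\<close> between \<open>0\<close> and the barrier, since the test is made with the
  value of the supersolution, which may lie below the barrier. Staying at distance
  at least \<open>R / 2\<close> from the centre keeps the term quadratic in \<open>\<alpha>\<close> nondegenerate.\<close>

lemma gauss_barrier_strict_subsolution:
  fixes c :: "real^'n" and f :: "real \<Rightarrow> real"
  assumes "0 < l" and "l \<le> M" and "0 \<le> \<gamma>" and "0 \<le> d" and "0 \<le> a"
    and f: "\<And>s. 0 < s \<Longrightarrow> f s = a * s * \<bar>ln s\<bar>" and "f 0 = 0"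
    and "0 < m" and "0 < R"
  shows "\<exists>\<alpha>>0. \<forall>x s. R / 2 \<le> norm (x - c) \<longrightarrow> norm (x - c) \<le> R \<longrightarrow> 0 \<le> s \<longrightarrow>
    s \<le> gauss_barrier m \<alpha> R c x \<longrightarrow>
    f s < L1_minus l M \<gamma> d (gauss_hess m \<alpha> c x) (gauss_grad m \<alpha> c x) s"
proof -
  have "0 \<le> 2 * M * CARD('n) + 2 * \<gamma> * R + a * R\<^sup>2" "0 \<le> d + a * (\<bar>ln m\<bar> + 1)" "0 < l * R\<^sup>2"
    using assms by auto
  then obtain \<alpha> where \<alpha>: "\<alpha> > 0"
      "(2 * M * CARD('n) + 2 * \<gamma> * R + a * R\<^sup>2) * \<alpha> + (d + a * (\<bar>ln m\<bar> + 1)) < l * R\<^sup>2 * \<alpha>\<^sup>2"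
    using quadratic_beats_linear by blast
  show ?thesis
  proof (intro exI[of _ \<alpha>] conjI allI impI)
    show "0 < \<alpha>" by fact
    fix x s assume x: "R / 2 \<le> norm (x - c)" "norm (x - c) \<le> R"
      and s: "0 \<le> s" "s \<le> gauss_barrier m \<alpha> R c x"
    define r where "r = norm (x - c)"
    define E where "E = m * exp (- (\<alpha> * r\<^sup>2))"
    have E: "0 < E" using \<open>0 < m\<close> by (simp add: E_def)
    have "gauss_barrier m \<alpha> R c x \<le> E"
      using \<open>0 < m\<close> by (simp add: gauss_barrier_def E_def r_def power2_norm_eq_inner)
    then have sE: "s \<le> E" using s by simp
    have rsq: "R\<^sup>2 / 4 \<le> r\<^sup>2" "r\<^sup>2 \<le> R\<^sup>2"
      using power_mono[OF x(1), of 2] power_mono[OF x(2), of 2] \<open>0 < R\<close>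
      by (auto simp: r_def power_divide)
    have "f s \<le> a * (E * (\<bar>ln m\<bar> + \<alpha> * r\<^sup>2 + 1))"
    proof (cases "s = 0")
      case True
      then show ?thesis using E assms(5,7) \<alpha>(1) by simp
    next
      case False
      then have "s * \<bar>ln s\<bar> \<le> E * (\<bar>ln m\<bar> + \<alpha> * r\<^sup>2 + 1)"
        using entropy_le[of s m "\<alpha> * r\<^sup>2"] s sE \<open>0 < m\<close> \<alpha>(1) by (simp add: E_def)
      then show ?thesis using f[of s] False s(1) assms(5) by (simp add: mult.assoc mult_left_mono)
    qed
    also have "\<dots> \<le> a * (E * (\<bar>ln m\<bar> + \<alpha> * R\<^sup>2 + 1))"
      using rsq(2) E \<alpha>(1) assms(5) by (intro mult_left_mono) auto
    finally have fs: "f s \<le> E * (a * (\<bar>ln m\<bar> + 1) + a * R\<^sup>2 * \<alpha>)"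
      by (simp add: algebra_simps)
    have ds: "d * s \<le> E * d" using mult_left_mono[OF sE assms(4)] by (simp add: mult.commute)
    have "4 * \<alpha>\<^sup>2 * l * (R\<^sup>2 / 4) \<le> 4 * \<alpha>\<^sup>2 * l * r\<^sup>2"
      using rsq(1) assms(1) by (intro mult_left_mono) auto
    moreover have "2 * \<alpha> * \<gamma> * r \<le> 2 * \<alpha> * \<gamma> * R"
      using x(2) assms(3) \<alpha>(1) by (intro mult_left_mono) (auto simp: r_def)
    ultimately have "d + (a * (\<bar>ln m\<bar> + 1) + a * R\<^sup>2 * \<alpha>)
        < 4 * \<alpha>\<^sup>2 * l * r\<^sup>2 - 2 * \<alpha> * M * CARD('n) - 2 * \<alpha> * \<gamma> * r"
      using \<alpha>(2) by (simp add: algebra_simps)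
    then have "E * (d + (a * (\<bar>ln m\<bar> + 1) + a * R\<^sup>2 * \<alpha>))
        < E * (4 * \<alpha>\<^sup>2 * l * r\<^sup>2 - 2 * \<alpha> * M * CARD('n) - 2 * \<alpha> * \<gamma> * r)"
      using E by (rule mult_strict_left_mono)
    then have "f s < E * (4 * \<alpha>\<^sup>2 * l * r\<^sup>2 - 2 * \<alpha> * M * CARD('n) - 2 * \<alpha> * \<gamma> * r) - d * s"
      using fs ds by (simp only: distrib_left)
    also have "\<dots> \<le> L1_minus l M \<gamma> d (gauss_hess m \<alpha> c x) (gauss_grad m \<alpha> c x) s"
      using L1_minus_gauss_ge[OF assms(2), of \<alpha> m x c \<gamma> d s] \<alpha>(1) \<open>0 < m\<close>
      by (simp add: E_def r_def)
    finally show "f s < L1_minus l M \<gamma> d (gauss_hess m \<alpha> c x) (gauss_grad m \<alpha> c x) s" .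
  qed
qed

section \<open>The strong maximum principle\<close>

text \<open>The contradiction comes from testing with the barrier at a minimum of \<open>u\<close> minus the barrier
  over a small ball around the contact point \<open>z\<close>.\<close>

lemma no_touching_ball:
  fixes S :: "(real^'n) set" and f :: "real \<Rightarrow> real"
  assumes "open S" and "0 < l" and "l \<le> M" and "0 \<le> \<gamma>" and "0 \<le> d" and "0 \<le> a"
    and f: "\<And>s. 0 < s \<Longrightarrow> f s = a * s * \<bar>ln s\<bar>" and "f 0 = 0"
    and sup: "visc_supersol (L1_minus l M \<gamma> d) f S u"
    and nonneg: "\<And>x. x \<in> S \<Longrightarrow> 0 \<le> u x"
    and "0 < R" and "z \<in> S" and "dist c z = R" and "u z = 0"
    and pos: "\<And>y. dist c y \<le> R \<Longrightarrow> y \<noteq> z \<Longrightarrow> 0 < u y"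
  shows False
proof -
  have lsc: "lsc_on S u" using sup by (simp add: visc_supersol_def)
  obtain e where e: "e > 0" "cball z e \<subseteq> S"
    using assms(1,12) open_contains_cball by metis
  \<comment> \<open>Radius at most \<open>R / 2\<close> keeps the ball around \<open>z\<close> at distance \<open>R / 2\<close> from the centre
      \<open>c\<close>, where the barrier is a strict subsolution.\<close>
  define \<rho> where "\<rho> = min e (R / 2)"
  have \<rho>: "0 < \<rho>" "\<rho> \<le> R / 2" "cball z \<rho> \<subseteq> S"
    using e \<open>0 < R\<close> by (auto simp: \<rho>_def)
  have "\<exists>m>0. \<forall>x\<in>sphere z \<rho> \<inter> cball c R. m \<le> u x"
  proof (cases "sphere z \<rho> \<inter> cball c R = {}")
    case True
    then show ?thesis by (intro exI[of _ 1]) auto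
  next
    case False
    have "compact (sphere z \<rho> \<inter> cball c R)" by (simp add: compact_Int)
    moreover have "lsc_on (sphere z \<rho> \<inter> cball c R) u"
      using lsc by (rule lsc_on_subset) (use \<rho>(3) in auto)
    ultimately obtain x where "x \<in> sphere z \<rho> \<inter> cball c R"
        "\<forall>y\<in>sphere z \<rho> \<inter> cball c R. u x \<le> u y"
      using lsc_on_compact_attains_min False by blast
    then show ?thesis using pos[of x] \<rho>(1) by (intro exI[of _ "u x"]) auto
  qed
  then obtain m where m: "0 < m" "\<And>x. x \<in> sphere z \<rho> \<Longrightarrow> x \<in> cball c R \<Longrightarrow> m \<le> u x"
    by blast
  obtain \<alpha> where \<alpha>: "\<alpha> > 0" and strict: "\<And>x s. R / 2 \<le> norm (x - c) \<Longrightarrow> norm (x - c) \<le> R \<Longrightarrow>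
      0 \<le> s \<Longrightarrow> s \<le> gauss_barrier m \<alpha> R c x \<Longrightarrow>
      f s < L1_minus l M \<gamma> d (gauss_hess m \<alpha> c x) (gauss_grad m \<alpha> c x) s"
    using gauss_barrier_strict_subsolution[OF assms(2-6) f assms(8) m(1) \<open>0 < R\<close>, of c] by blast
  let ?v = "gauss_barrier m \<alpha> R c"
  have v_out: "?v x < 0" if "R < norm (x - c)" for x
  proof -
    have "R\<^sup>2 < (norm (x - c))\<^sup>2" using that \<open>0 < R\<close> by (intro power_strict_mono) auto
    then show ?thesis
      using m(1) \<alpha> by (simp add: gauss_barrier_def power2_norm_eq_inner mult_less_0_iff)
  qed
  have v_lt: "?v x < m" for x
  proof -
    have "exp (- \<alpha> * ((x - c) \<bullet> (x - c))) \<le> 1" using \<alpha> by simp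
    then have "exp (- \<alpha> * ((x - c) \<bullet> (x - c))) - exp (- \<alpha> * R\<^sup>2) < 1"
      using exp_gt_zero[of "- \<alpha> * R\<^sup>2"] by linarith
    from mult_strict_left_mono[OF this m(1)] show ?thesis by (simp add: gauss_barrier_def)
  qed
  have "norm (z - c) = R" using assms(13) by (simp add: dist_norm norm_minus_commute)
  then have vz: "?v z = 0" by (simp add: gauss_barrier_def power2_norm_eq_inner[symmetric])
  have "lsc_on (cball z \<rho>) (\<lambda>x. u x - ?v x)"
    by (intro lsc_on_diff_continuous lsc_on_subset[OF lsc \<rho>(3)] continuous_on_gauss_barrier)
  moreover have "cball z \<rho> \<noteq> {}" using \<rho>(1) by auto
  ultimately obtain y where y: "y \<in> cball z \<rho>" "\<And>x. x \<in> cball z \<rho> \<Longrightarrow> u y - ?v y \<le> u x - ?v x"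
    using lsc_on_compact_attains_min[OF compact_cball, of z \<rho> "\<lambda>x. u x - ?v x"] by blast
  have yS: "y \<in> S" using y \<rho> by auto
  have uv: "u y \<le> ?v y" using y(2)[of z] vz assms(14) \<rho>(1) by simp
  have yR: "norm (y - c) \<le> R"
    using v_out[of y] nonneg[OF yS] uv by fastforce
  then have yc: "y \<in> cball c R" by (simp add: dist_norm norm_minus_commute)
  have "y \<notin> sphere z \<rho>"
    using m(2)[OF _ yc] v_lt[of y] uv by fastforce
  then have yball: "y \<in> ball z \<rho>" using y(1) by auto
  have "norm (z - c) \<le> norm (y - c) + norm (z - y)"
    by (metis add.commute diff_add_cancel add_diff_eq norm_triangle_ineq)
  then have "R / 2 \<le> norm (y - c)"
    using \<open>norm (z - c) = R\<close> yball \<rho>(2) by (simp add: dist_norm)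
  then have "f (u y) < L1_minus l M \<gamma> d (gauss_hess m \<alpha> c y) (gauss_grad m \<alpha> c y) (u y)"
    using strict yR nonneg[OF yS] uv by blast
  moreover have "\<forall>\<^sub>F x in at y. u y - ?v y \<le> u x - ?v x"
    unfolding eventually_at_topological
    using y(2) yball by (intro exI[of _ "ball z \<rho>"]) auto
  then have "L1_minus l M \<gamma> d (gauss_hess m \<alpha> c y) (gauss_grad m \<alpha> c y) (u y) \<le> f (u y)"
    using conjunct2[OF sup[unfolded visc_supersol_def], rule_format, OF yS, of UNIV ?v]
      gauss_barrier_C2[of UNIV m \<alpha> R c] by simp
  ultimately show False by simp
qed

theorem lemma5p3:
  fixes \<Omega> :: "(real^'n) set"
    and u :: "real^'n \<Rightarrow> real"
    and f :: "real \<Rightarrow> real"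
    and \<gamma> d a lam\<^sub>P Lam\<^sub>P :: real
  assumes "open \<Omega>" and "connected \<Omega>" and "bounded \<Omega>" and "C11_boundary \<Omega>"
    and "0 < lam\<^sub>P" and "lam\<^sub>P \<le> Lam\<^sub>P"
    and "0 \<le> \<gamma>" and "0 \<le> d" and "0 \<le> a"
    and "\<And>s. 0 < s \<Longrightarrow> f s = a * s * \<bar>ln s\<bar>" and "f 0 = 0"
    and "visc_supersol (L1_minus lam\<^sub>P Lam\<^sub>P \<gamma> d) f \<Omega> u"
    and "\<And>x. x \<in> \<Omega> \<Longrightarrow> 0 \<le> u x"
  shows "(\<forall>x\<in>\<Omega>. 0 < u x) \<or> (\<forall>x\<in>\<Omega>. u x = 0)"
proof (rule ccontr)
  assume neg: "\<not> ?thesis"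
  define P where "P = {x \<in> \<Omega>. 0 < u x}"
  have lsc: "lsc_on \<Omega> u" using assms(12) by (simp add: visc_supersol_def)
  have "open P"
    unfolding open_contains_ball
  proof
    fix x assume x: "x \<in> P"
    then obtain e where e: "e > 0" "\<forall>y\<in>ball x e. 0 < u y"
      using lsc_on_openD[OF lsc assms(1), of x 0] unfolding P_def by blast
    obtain e' where e': "e' > 0" "ball x e' \<subseteq> \<Omega>"
      using assms(1) x open_contains_ball by (metis (no_types, lifting) P_def mem_Collect_eq)
    show "\<exists>e>0. ball x e \<subseteq> P"
      using e e' by (intro exI[of _ "min e e'"]) (auto simp: P_def)
  qed
  moreover have "P \<noteq> {}" "P \<noteq> \<Omega>" "P \<subseteq> \<Omega>"
    using neg assms(13) by (force simp: P_def)+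
  ultimately obtain c R z where touch: "0 < R" "z \<in> \<Omega> - P" "dist c z = R"
      "\<And>y. dist c y \<le> R \<Longrightarrow> y \<noteq> z \<Longrightarrow> y \<in> P"
    using interior_touching_ball[OF assms(1,2)] by metis
  have "z \<in> \<Omega>" "u z = 0" using touch(2) assms(13)[of z] by (auto simp: P_def)
  then show False
    using no_touching_ball[OF assms(1) assms(5-9) assms(10) assms(11-13) touch(1) _ touch(3)] touch(4)
    by (auto simp: P_def)
qed

end
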